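(* There is an infinite family of trees $\{P_i\}_{i\in\mathbb{N}}$ with the following property. Consider any Discoverer algorithm that wins the source detection game with consistent source behavior and known static graph, on tree graphs, with success probability $p>0$. Then the price of detection under that algorithm on this family is asymptotically equivalent to $n\log n$, where $n$ is the number of nodes.
   Context: A temporal graph $\mathcal{G}=(V,E,\lambda)$ with lifetime $T_{\max}$ consists of a finite simple undirected graph $(V,E)$, called the underlying static graph, together with a labeling $\lambda\colon E\to\{1,\dots,T_{\max}\}$. The edge $e$ is present only at time $\lambda(e)$. Write $n=|V|$. Infections follow the SIR model with duration $\delta\ge1$. A node may be seed-infected at some time. A susceptible node $u$ becomes infected at time $t$ iff some neighbor $v$ is infectious at time $t$ and $\lambda(uv)=t$; exactly one such neighbor counts as its infector. The node $u$ is then infectious at times $t+1,\dots,t+\delta$ and resistant afterwards. SD game: an Adversary fixes the temporal graph, $T_{\max}$, $\delta$, and a source node $s$. The Discoverer is told $V$, $E$ (known static graph), $T_{\max}$ and $\delta$, but not $\lambda$. In each round the Discoverer watches one node. All nodes start susceptible, the source is seed-infected, and an infection chain unfolds. The Discoverer learns whether, when, and by which neighbor the watched node was infected (or that it was the seed). Consistent source behavior means the same seed time and the same infection chain are used in every round. The Discoverer eventually names a node and wins iff it is $s$. The price of detection is the total number of nodes infected, summed over all rounds, until the Discoverer stops. Two functions $f,g\colon\mathbb{N}\to\mathbb{R}$ are asymptotically equivalent if $f(n)/g(n)\to1$ as $n\to\infty$.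
   Formalization: Wasteful winning algorithms can cost more, so any winning algorithm is shown to pay asymptotically at least n log n (base 2), and equivalence holds for asymptotically optimal ones, which exist; price is the worst case over the Adversary's choices and all plays of positive probability. *)

theory Defs
  imports "HOL-Probability.Probability"
begin

type_synonym 'v sgraph = "'v set \<times> 'v set set"

definition simple_graph :: "'v sgraph \<Rightarrow> bool" where
  "simple_graph G \<longleftrightarrow> finite (fst G) \<and> (\<forall>e\<in>snd G. e \<subseteq> fst G \<and> card e = 2)"

definition connected_graph :: "'v sgraph \<Rightarrow> bool" where
  "connected_graph G \<longleftrightarrow>
     (\<forall>u\<in>fst G. \<forall>v\<in>fst G. (u, v) \<in> {(x, y). {x, y} \<in> snd G}\<^sup>*)"

definition graph_cycle :: "'v sgraph \<Rightarrow> 'v list \<Rightarrow> bool" where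
  "graph_cycle G xs \<longleftrightarrow> length xs \<ge> 3 \<and> distinct xs \<and>
     (\<forall>i. Suc i < length xs \<longrightarrow> {xs ! i, xs ! Suc i} \<in> snd G) \<and> {last xs, hd xs} \<in> snd G"

definition tree_graph :: "'v sgraph \<Rightarrow> bool" where
  "tree_graph G \<longleftrightarrow> simple_graph G \<and> fst G \<noteq> {} \<and> connected_graph G \<and> (\<nexists>xs. graph_cycle G xs)"

text \<open>
  What is learned about a watched node: None if it was never infected, Some (t, None) if it was
  the seed, infected at time t, and Some (t, Some v) if it was infected at time t by v.
  An infection chain assigns this information to every node.
\<close>

type_synonym 'v obs = "(nat \<times> 'v option) option"

type_synonym 'v chain = "'v \<Rightarrow> 'v obs"

definition infected_at :: "'v chain \<Rightarrow> 'v \<Rightarrow> nat \<Rightarrow> bool" where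
  "infected_at c u t \<longleftrightarrow> (\<exists>w. c u = Some (t, w))"

definition susceptible_at :: "'v chain \<Rightarrow> 'v \<Rightarrow> nat \<Rightarrow> bool" where
  "susceptible_at c u t \<longleftrightarrow> (\<forall>t'<t. \<not> infected_at c u t')"

definition infectious_at :: "nat \<Rightarrow> 'v chain \<Rightarrow> 'v \<Rightarrow> nat \<Rightarrow> bool" where
  "infectious_at \<delta> c v t \<longleftrightarrow> (\<exists>t'. infected_at c v t' \<and> t' + 1 \<le> t \<and> t \<le> t' + \<delta>)"

definition can_infect :: "'v sgraph \<Rightarrow> ('v set \<Rightarrow> nat) \<Rightarrow> nat \<Rightarrow> 'v chain \<Rightarrow> 'v \<Rightarrow> 'v \<Rightarrow> nat \<Rightarrow> bool" where
  "can_infect G lam \<delta> c v u t \<longleftrightarrow> {u, v} \<in> snd G \<and> lam {u, v} = t \<and> infectious_at \<delta> c v t"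

definition infection_chain ::
  "'v sgraph \<Rightarrow> ('v set \<Rightarrow> nat) \<Rightarrow> nat \<Rightarrow> 'v \<Rightarrow> nat \<Rightarrow> 'v chain \<Rightarrow> bool" where
  "infection_chain G lam \<delta> s t0 c \<longleftrightarrow>
     c s = Some (t0, None) \<and>
     (\<forall>u. u \<notin> fst G \<longrightarrow> c u = None) \<and>
     (\<forall>u \<in> fst G - {s}. \<forall>t.
        infected_at c u t \<longleftrightarrow> susceptible_at c u t \<and> (\<exists>v. can_infect G lam \<delta> c v u t)) \<and>
     (\<forall>u \<in> fst G - {s}. \<forall>t w. c u = Some (t, w) \<longrightarrow> (\<exists>v. w = Some v \<and> can_infect G lam \<delta> c v u t))"

text \<open>
  The choices of the Adversary. Consistent source behaviour is built in: a single seed time t0 and a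
  single infection chain c are fixed for all rounds.
\<close>

definition sd_instance ::
  "'v sgraph \<Rightarrow> nat \<Rightarrow> nat \<Rightarrow> ('v set \<Rightarrow> nat) \<Rightarrow> 'v \<Rightarrow> nat \<Rightarrow> 'v chain \<Rightarrow> bool" where
  "sd_instance G Tmax \<delta> lam s t0 c \<longleftrightarrow>
     simple_graph G \<and> lam \<in> snd G \<rightarrow> {1..Tmax} \<and> 1 \<le> \<delta> \<and> s \<in> fst G \<and> t0 \<le> Tmax \<and>
     infection_chain G lam \<delta> s t0 c"

datatype 'v action = Watch (node: 'v) | Name (node: 'v)

text \<open>
  A (randomized, adaptive) Discoverer algorithm knows the static graph, the lifetime, the duration
  and the history of watched nodes with the answers received; it draws its next action from a
  distribution depending on these.
\<close>

type_synonym 'v history = "('v \<times> 'v obs) list"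

type_synonym 'v discoverer = "'v sgraph \<Rightarrow> nat \<Rightarrow> nat \<Rightarrow> 'v history \<Rightarrow> 'v action pmf"

text \<open>
  The state of the game, started at history h, after at most k further actions: the history, and the
  node named if the Discoverer has stopped.
\<close>

primrec play ::
  "('v history \<Rightarrow> 'v action pmf) \<Rightarrow> 'v chain \<Rightarrow> nat \<Rightarrow> 'v history \<Rightarrow> ('v history \<times> 'v option) pmf" where
  "play \<sigma> c 0 h = return_pmf (h, None)"
| "play \<sigma> c (Suc k) h = bind_pmf (\<sigma> h) (\<lambda>a. case a of
       Name v \<Rightarrow> return_pmf (h, Some v)
     | Watch v \<Rightarrow> play \<sigma> c k (h @ [(v, c v)]))"

definition win_prob :: "('v history \<Rightarrow> 'v action pmf) \<Rightarrow> 'v chain \<Rightarrow> 'v \<Rightarrow> real" where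
  "win_prob \<sigma> c s = (SUP k. measure_pmf.prob (play \<sigma> c k []) {(h, r). r = Some s})"

definition wins_on_trees :: "real \<Rightarrow> 'v discoverer \<Rightarrow> bool" where
  "wins_on_trees p A \<longleftrightarrow> (\<forall>G. tree_graph G \<longrightarrow>
     (\<forall>Tmax \<delta> h. node ` set_pmf (A G Tmax \<delta> h) \<subseteq> fst G) \<and>
     (\<forall>Tmax \<delta> lam s t0 c. sd_instance G Tmax \<delta> lam s t0 c \<longrightarrow> p \<le> win_prob (A G Tmax \<delta>) c s))"

text \<open>
  Worst-case price on the static graph G: the supremum is over the Adversary's choices and over all
  plays of positive probability. Each of the rounds in a history infects the same set of nodes.
  Plays that go on for arbitrarily many rounds make the price infinite.
\<close>

definition price :: "'v discoverer \<Rightarrow> 'v sgraph \<Rightarrow> enat" where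
  "price A G = Sup {enat (\<Sum>j<length h. card {u \<in> fst G. c u \<noteq> None}) |
     Tmax \<delta> lam s t0 c k h r.
       sd_instance G Tmax \<delta> lam s t0 c \<and> (h, r) \<in> set_pmf (play (A G Tmax \<delta>) c k [])}"

definition asymp_optimal :: "real \<Rightarrow> (nat \<Rightarrow> 'v sgraph) \<Rightarrow> 'v discoverer \<Rightarrow> bool" where
  "asymp_optimal p P A \<longleftrightarrow> wins_on_trees p A \<and>
     (\<forall>B. wins_on_trees p B \<longrightarrow> (\<forall>\<epsilon>>0. \<forall>\<^sub>F i in sequentially.
        ereal_of_enat (price A (P i)) \<le> ereal (1 + \<epsilon>) * ereal_of_enat (price B (P i))))"

definition price_ratio :: "'v discoverer \<Rightarrow> 'v sgraph \<Rightarrow> ereal" where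
  "price_ratio A G =
     ereal_of_enat (price A G) / ereal (real (card (fst G)) * log 2 (real (card (fst G))))"

end

theory Submission
  imports Defs "HOL-Real_Asymp.Real_Asymp"
begin

text \<open>
  The trees are the paths on 2^i nodes. If the labels increase in both directions away from the
  source, every round infects all n nodes and a watched node only reveals on which side of it the
  source lies; k rounds therefore separate at most 2^(k+1) - 1 sources, and a success probability p
  requires log n - O(1) rounds. Conversely, the infected nodes of a path always form an interval of
  some length m around the source. An infected node is found by O(n / m) equally spaced probes at
  total cost O(n), and from then on even an uninfected node reveals the side of the source, so
  watching the median of the sources that are still possible takes log n + 1 further rounds of cost
  m. Since the lower bound holds for every winning algorithm and is attained up to O(n), every
  asymptotically optimal algorithm has price asymptotic to n log n.
\<close>

section \<open>Paths\<close>

definition path_graph :: "nat \<Rightarrow> nat sgraph" where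
  "path_graph n = ({..<n}, {{v, Suc v} | v. Suc v < n})"

lemma fst_path_graph [simp]: "fst (path_graph n) = {..<n}"
  by (simp add: path_graph_def)

lemma path_graph_edge_iff:
  "{u, v} \<in> snd (path_graph n) \<longleftrightarrow> (v = Suc u \<or> u = Suc v) \<and> u < n \<and> v < n"
  by (auto simp: path_graph_def doubleton_eq_iff)

lemma connected_path_graph: "connected_graph (path_graph n)"
proof -
  let ?r = "{(x, y). {x, y} \<in> snd (path_graph n)}"
  have up: "v < n \<Longrightarrow> (0, v) \<in> ?r\<^sup>*" for v
  proof (induction v)
    case (Suc v)
    then have "(v, Suc v) \<in> ?r" by (simp add: path_graph_edge_iff)
    with Suc show ?case by (auto intro: rtrancl_into_rtrancl)
  qed simp
  have "sym ?r" by (auto simp: sym_def insert_commute)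
  then have "sym (?r\<^sup>*)" by (rule sym_rtrancl)
  with up have down: "u < n \<Longrightarrow> (u, 0) \<in> ?r\<^sup>*" for u by (auto dest: symD)
  show ?thesis
    unfolding connected_graph_def using rtrancl_trans[OF down up] by auto
qed

lemma acyclic_path_graph: "\<not> graph_cycle (path_graph n) xs"
proof
  assume cyc: "graph_cycle (path_graph n) xs"
  define l where "l = length xs"
  have "xs \<noteq> []" using cyc by (auto simp: graph_cycle_def)
  then have l: "3 \<le> l" and dist: "distinct xs"
    and step: "\<And>i. Suc i < l \<Longrightarrow> {xs ! i, xs ! Suc i} \<in> snd (path_graph n)"
    and wrap: "{xs ! (l - 1), xs ! 0} \<in> snd (path_graph n)"
    using cyc by (auto simp: graph_cycle_def l_def last_conv_nth hd_conv_nth)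
  from \<open>xs \<noteq> []\<close> have "Max (set xs) \<in> set xs" by simp
  then obtain i where i: "i < l" "xs ! i = Max (set xs)"
    by (auto simp: in_set_conv_nth l_def)
  \<comment> \<open>Both cyclic neighbours of the largest vertex would have to be its predecessor.\<close>
  define a where "a = (if i = 0 then l - 1 else i - 1)"
  define b where "b = (if Suc i = l then 0 else Suc i)"
  have ab: "a < l" "b < l" "a \<noteq> b"
    using i l by (auto simp: a_def b_def split: if_splits)
  have "{xs ! a, xs ! i} \<in> snd (path_graph n)"
    using step[of "i - 1"] wrap i l by (auto simp: a_def)
  moreover have "{xs ! i, xs ! b} \<in> snd (path_graph n)"
    using step[of i] wrap i l by (auto simp: b_def)
  moreover have "xs ! a \<le> xs ! i" "xs ! b \<le> xs ! i"
    using i ab by (auto simp: l_def)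
  ultimately have "xs ! a = xs ! b"
    by (auto simp: path_graph_edge_iff)
  with ab dist show False by (simp add: l_def nth_eq_iff_index_eq)
qed

lemma tree_path_graph:
  assumes "0 < n"
  shows "tree_graph (path_graph n)"
proof -
  have "simple_graph (path_graph n)"
    by (auto simp: simple_graph_def path_graph_def)
  then show ?thesis
    using assms connected_path_graph acyclic_path_graph by (auto simp: tree_graph_def)
qed

section \<open>Infections on paths\<close>

lemma infection_chain_seed_unique:
  assumes "infection_chain G lam \<delta> s t0 c" and "c v = Some (t, None)"
  shows "v = s"
proof (rule ccontr)
  assume "v \<noteq> s"
  moreover have "v \<in> fst G" using assms by (auto simp: infection_chain_def)
  ultimately show False using assms unfolding infection_chain_def by blast
qed

lemma infection_chain_infector:
  assumes "infection_chain G lam \<delta> s t0 c" and "c u = Some (t, w)" and "u \<noteq> s"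
  obtains v t' w' where "w = Some v" "{u, v} \<in> snd G" "c v = Some (t', w')" "t' < t"
proof -
  have "u \<in> fst G" using assms unfolding infection_chain_def by fastforce
  then obtain v where "w = Some v" "can_infect G lam \<delta> c v u t"
    using assms unfolding infection_chain_def by blast
  then show ?thesis
    using that by (auto simp: can_infect_def infectious_at_def infected_at_def)
qed

lemma path_infector_left:
  assumes chain: "infection_chain (path_graph n) lam \<delta> s t0 c"
    and "c u = Some (t, w)" and "u < s"
  shows "w = Some (Suc u) \<and> c (Suc u) \<noteq> None"
  using assms(2,3)
proof (induction t arbitrary: u w rule: less_induct)
  case (less t)
  obtain v t' w' where v: "w = Some v" "{u, v} \<in> snd (path_graph n)" "c v = Some (t', w')" "t' < t"
    using infection_chain_infector[OF chain less.prems(1)] less.prems(2) by blast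
  show ?case
  proof (cases "v = Suc u")
    case False
    then have u: "u = Suc v" using v by (auto simp: path_graph_edge_iff)
    then have "w' = Some u" using less.IH[OF v(4,3)] less.prems by simp
    then obtain t'' where "t'' < t'" "c u = Some (t'', snd (the (c u)))"
      using infection_chain_infector[OF chain v(3)] u less.prems by (metis Suc_lessD less_irrefl option.inject option.sel snd_conv)
    then show ?thesis using less.prems v by simp
  qed (use v in auto)
qed

lemma path_infector_right:
  assumes chain: "infection_chain (path_graph n) lam \<delta> s t0 c"
    and "c u = Some (t, w)" and "s < u"
  shows "w = Some (u - 1) \<and> c (u - 1) \<noteq> None"
  using assms(2,3)
proof (induction t arbitrary: u w rule: less_induct)
  case (less t)
  obtain v t' w' where v: "w = Some v" "{u, v} \<in> snd (path_graph n)" "c v = Some (t', w')" "t' < t"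
    using infection_chain_infector[OF chain less.prems(1)] less.prems(2) by blast
  show ?case
  proof (cases "u = Suc v")
    case False
    then have u: "v = Suc u" using v by (auto simp: path_graph_edge_iff)
    then have "w' = Some u" using less.IH[OF v(4,3)] less.prems by simp
    then obtain t'' where "t'' < t'" "c u = Some (t'', snd (the (c u)))"
      using infection_chain_infector[OF chain v(3)] u less.prems by (metis less_SucI less_irrefl option.inject option.sel snd_conv)
    then show ?thesis using less.prems v by simp
  qed (use v in auto)
qed

lemma path_infected_between_left:
  assumes chain: "infection_chain (path_graph n) lam \<delta> s t0 c"
    and "c u \<noteq> None" and "u \<le> x" and "x \<le> s"
  shows "c x \<noteq> None"
  using assms(3,4)
proof (induction x rule: dec_induct)
  case base
  show ?case using assms(2) .
next
  case (step x)
  then show ?case using path_infector_left[OF chain, of x] by (cases "c x") auto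
qed

lemma path_infected_between_right:
  assumes chain: "infection_chain (path_graph n) lam \<delta> s t0 c"
    and "c u \<noteq> None" and "s \<le> x" and "x \<le> u"
  shows "c x \<noteq> None"
  using assms(4,3)
proof (induction x rule: inc_induct)
  case base
  show ?case using assms(2) .
next
  case (step x)
  then show ?case using path_infector_right[OF chain, of "Suc x"] by (cases "c (Suc x)") auto
qed

lemma path_infected_interval:
  assumes chain: "infection_chain (path_graph n) lam \<delta> s t0 c"
  obtains a m where "{u \<in> {..<n}. c u \<noteq> None} = {a..<a + m}" and "0 < m"
proof -
  define I where "I = {u \<in> {..<n}. c u \<noteq> None}"
  have s: "s \<in> I" using chain unfolding infection_chain_def I_def by fastforce
  have fin: "finite I" by (simp add: I_def)
  have mem: "Min I \<in> I" "Max I \<in> I"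
    using Min_in[OF fin] Max_in[OF fin] s by auto
  have le: "Min I \<le> s" "s \<le> Max I"
    using Min_le[OF fin s] Max_ge[OF fin s] by auto
  have "x \<in> I" if "Min I \<le> x" "x \<le> Max I" for x
    using that mem path_infected_between_left[OF chain, of "Min I" x]
      path_infected_between_right[OF chain, of "Max I" x]
    by (cases "x \<le> s") (auto simp: I_def)
  moreover have "Min I \<le> x \<and> x \<le> Max I" if "x \<in> I" for x
    using Min_le[OF fin that] Max_ge[OF fin that] by simp
  ultimately have "x \<in> I \<longleftrightarrow> x \<in> {Min I..<Min I + (Suc (Max I) - Min I)}" for x
    using le by (metis add_diff_inverse_nat atLeastLessThan_iff le_SucI le_trans less_Suc_eq_le
      linorder_not_less)
  then have "I = {Min I..<Min I + (Suc (Max I) - Min I)}" by blast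
  moreover have "0 < Suc (Max I) - Min I" using le by linarith
  ultimately show ?thesis using that I_def by metis
qed

text \<open>An uninfected node also tells the side of the source, once some infected node is known.\<close>

lemma path_source_side:
  assumes chain: "infection_chain (path_graph n) lam \<delta> s t0 c"
    and chain': "infection_chain (path_graph n) lam' \<delta>' s' t0' c'"
    and v: "c' v = c v" and a: "c' a = c a" "c a \<noteq> None" and "v \<noteq> s"
  shows "(v < s \<and> v < s') \<or> (s < v \<and> s' < v)"
proof (cases "c v")
  case None
  then have "a \<noteq> v" using a by auto
  have "c s \<noteq> None" "c' s' \<noteq> None"
    using chain chain' by (auto simp: infection_chain_def)
  then have "v \<noteq> s'" using None v by auto
  then show ?thesis
    using path_infected_between_left[OF chain, of a v] path_infected_between_right[OF chain, of a v]
      path_infected_between_left[OF chain', of a v] path_infected_between_right[OF chain', of a v]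
      None v a \<open>a \<noteq> v\<close> \<open>v \<noteq> s\<close>
    by (metis linorder_neqE_nat nat_less_le)
next
  case (Some tw)
  obtain t w where tw: "c v = Some (t, w)" using Some by (cases tw) auto
  have "v \<noteq> s'"
  proof
    assume "v = s'"
    then have "c v = Some (t0', None)" using chain' v by (simp add: infection_chain_def)
    then show False using infection_chain_seed_unique[OF chain] \<open>v \<noteq> s\<close> by blast
  qed
  have tw': "c' v = Some (t, w)" using tw v by simp
  consider "v < s" "v < s'" | "s < v" "s' < v" | "v < s" "s' < v" | "s < v" "v < s'"
    using \<open>v \<noteq> s\<close> \<open>v \<noteq> s'\<close> by linarith
  then show ?thesis
  proof cases
    case 3
    then show ?thesis
      using path_infector_left[OF chain tw] path_infector_right[OF chain' tw'] by force
  next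
    case 4
    then show ?thesis
      using path_infector_right[OF chain tw] path_infector_left[OF chain' tw'] by force
  qed auto
qed

section \<open>The lower bound\<close>

text \<open>
  Labels increase in both directions away from the source and the time at which a node is infected
  depends only on the side on which the source lies, so that an observation reveals no more than
  that side.
\<close>

definition spreading_label :: "nat \<Rightarrow> nat \<Rightarrow> nat set \<Rightarrow> nat" where
  "spreading_label n s e = (if Max e \<le> s then n - Min e else Max e)"

definition spreading_chain :: "nat \<Rightarrow> nat \<Rightarrow> nat chain" where
  "spreading_chain n s v =
     (if n \<le> v then None
      else if v = s then Some (0, None)
      else if v < s then Some (n - v, Some (Suc v))
      else Some (v, Some (v - 1)))"

lemma spreading_chain_infected_at:
  "infected_at (spreading_chain n s) v t \<longleftrightarrow>
    v < n \<and> t = (if v = s then 0 else if v < s then n - v else v)"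
  by (auto simp: infected_at_def spreading_chain_def)

lemma spreading_label_edge:
  "spreading_label n s {v, Suc v} = (if v < s then n - v else Suc v)"
  by (auto simp: spreading_label_def)

lemma spreading_chain_can_infect:
  assumes "s < n" "u < n" "u \<noteq> s"
  shows "can_infect (path_graph n) (spreading_label n s) n (spreading_chain n s)
    (if u < s then Suc u else u - 1) u (if u < s then n - u else u)"
proof (cases "u < s")
  case True
  then show ?thesis
    using assms spreading_label_edge[of n s u]
    by (auto simp: can_infect_def path_graph_edge_iff infectious_at_def spreading_chain_infected_at)
next
  case False
  then obtain v where "u = Suc v" using assms by (cases u) auto
  with False show ?thesis
    using assms spreading_label_edge[of n s v]
    by (auto simp: can_infect_def path_graph_edge_iff infectious_at_def spreading_chain_infected_at
        insert_commute)
qed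

lemma spreading_chain_can_infect_time:
  assumes "can_infect (path_graph n) (spreading_label n s) n (spreading_chain n s) v u t"
    and "u \<noteq> s"
  shows "(if u < s then n - u else u) \<le> t"
proof -
  consider "v = Suc u" | "u = Suc v"
    using assms by (auto simp: can_infect_def path_graph_edge_iff)
  then show ?thesis
    using assms spreading_label_edge[of n s u] spreading_label_edge[of n s v]
    by cases (auto simp: can_infect_def path_graph_edge_iff insert_commute)
qed

lemma infection_chain_spreading:
  assumes "s < n"
  shows "infection_chain (path_graph n) (spreading_label n s) n s 0 (spreading_chain n s)"
proof -
  let ?c = "spreading_chain n s"
  let ?can = "can_infect (path_graph n) (spreading_label n s) n ?c"
  have "infected_at ?c u t \<longleftrightarrow> susceptible_at ?c u t \<and> (\<exists>v. ?can v u t)"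
    if u: "u \<in> {..<n} - {s}" for u t
  proof
    assume "infected_at ?c u t"
    then have "t = (if u < s then n - u else u)"
      using u by (simp add: spreading_chain_infected_at)
    then show "susceptible_at ?c u t \<and> (\<exists>v. ?can v u t)"
      using spreading_chain_can_infect[OF assms, of u] u
      unfolding susceptible_at_def spreading_chain_infected_at by auto
  next
    assume r: "susceptible_at ?c u t \<and> (\<exists>v. ?can v u t)"
    then have "(if u < s then n - u else u) \<le> t"
      using spreading_chain_can_infect_time u by blast
    moreover have "infected_at ?c u (if u < s then n - u else u)"
      using u by (simp add: spreading_chain_infected_at)
    ultimately show "infected_at ?c u t"
      using r unfolding susceptible_at_def by (metis le_neq_implies_less)
  qed
  moreover have "\<exists>v. w = Some v \<and> ?can v u t"
    if "u \<in> {..<n} - {s}" "?c u = Some (t, w)" for u t w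
    using that spreading_chain_can_infect[OF assms, of u]
    by (auto simp: spreading_chain_def split: if_splits)
  moreover have "?c s = Some (0, None)" using assms by (simp add: spreading_chain_def)
  ultimately show ?thesis
    by (auto simp: infection_chain_def spreading_chain_def)
qed

lemma sd_instance_spreading:
  assumes "s < n"
  shows "sd_instance (path_graph n) n n (spreading_label n s) s 0 (spreading_chain n s)"
proof -
  have "spreading_label n s e \<in> {1..n}" if e: "e \<in> snd (path_graph n)" for e
  proof -
    obtain v where "e = {v, Suc v}" "Suc v < n" using e by (auto simp: path_graph_def)
    then show ?thesis using assms by (auto simp: spreading_label_edge)
  qed
  moreover have "simple_graph (path_graph n)"
    using tree_path_graph[of n] assms by (simp add: tree_graph_def)
  ultimately show ?thesis
    using assms infection_chain_spreading[OF assms] by (auto simp: sd_instance_def)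
qed

lemma spreading_chain_infected:
  "{u \<in> {..<n}. spreading_chain n s u \<noteq> None} = {..<n}"
  by (auto simp: spreading_chain_def)

lemma prob_bind_pmf:
  "measure_pmf.prob (bind_pmf M f) X = measure_pmf.expectation M (\<lambda>x. measure_pmf.prob (f x) X)"
proof -
  have "ennreal (measure_pmf.prob (bind_pmf M f) X)
      = (\<integral>\<^sup>+x. ennreal (measure_pmf.prob (f x) X) \<partial>measure_pmf M)"
    by (simp add: measure_pmf.emeasure_eq_measure[symmetric])
  also have "\<dots> = ennreal (measure_pmf.expectation M (\<lambda>x. measure_pmf.prob (f x) X))"
    by (intro nn_integral_eq_integral measure_pmf.integrable_const_bound[where B = 1]) auto
  finally show ?thesis by (simp add: integral_nonneg_AE)
qed

lemma length_play:
  assumes "(h', r) \<in> set_pmf (play \<sigma> c k h)"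
  shows "length h \<le> length h'"
  using assms
proof (induction k arbitrary: h)
  case (Suc k)
  from Suc.prems obtain a where "a \<in> set_pmf (\<sigma> h)" and
    "(h', r) \<in> set_pmf (case a of Name v \<Rightarrow> return_pmf (h, Some v)
       | Watch v \<Rightarrow> play \<sigma> c k (h @ [(v, c v)]))"
    by auto
  then show ?case using Suc.IH[of "h @ [(node a, c (node a))]"] by (cases a) auto
qed simp

lemma prob_play_mono:
  "measure_pmf.prob (play \<sigma> c k h) {(h, r). r = Some s}
     \<le> measure_pmf.prob (play \<sigma> c (Suc k) h) {(h, r). r = Some s}"
proof (induction k arbitrary: h)
  case (Suc k)
  show ?case
    unfolding play.simps(2)[of \<sigma> c k h] play.simps(2)[of \<sigma> c "Suc k" h] prob_bind_pmf
    by (intro integral_mono measure_pmf.integrable_const_bound[where B = 1])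
       (auto split: action.split intro: Suc.IH simp del: play.simps)
qed simp

text \<open>
  With at most K watched nodes, a decision tree whose answers are left, right and found has at most
  2^K leaves and 2^K - 1 inner nodes, and each of them accounts for at most one source.
\<close>

lemma sum_prob_play_le:
  fixes c :: "'v::linorder \<Rightarrow> 'v chain"
  assumes "finite S"
    and right: "\<And>s v. s \<in> S \<Longrightarrow> s < v \<Longrightarrow> c s v = R v"
    and left: "\<And>s v. s \<in> S \<Longrightarrow> v < s \<Longrightarrow> c s v = L v"
    and "\<And>s h' r. s \<in> S \<Longrightarrow> (h', r) \<in> set_pmf (play \<sigma> (c s) k h) \<Longrightarrow> length h' \<le> length h + K"
  shows "(\<Sum>s\<in>S. measure_pmf.prob (play \<sigma> (c s) k h) {(h, r). r = Some s}) \<le> 2 ^ Suc K - 1"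
  using assms
proof (induction k arbitrary: h S K)
  case 0
  have "(1::real) \<le> 2 ^ Suc K" by (rule one_le_power) simp
  then show ?case by simp
next
  case (Suc k)
  let ?w = "\<lambda>k h s. measure_pmf.prob (play \<sigma> (c s) k h) {(h, r). r = Some s}"
  let ?f = "\<lambda>s a. case a of Name v \<Rightarrow> indicator {s} v | Watch v \<Rightarrow> ?w k (h @ [(v, c s v)]) s"
  have one: "(1::real) \<le> 2 * 2 ^ K" using one_le_power[of "2::real" "Suc K"] by simp
  have w: "?w (Suc k) h s = measure_pmf.expectation (\<sigma> h) (?f s)" for s
    unfolding play.simps prob_bind_pmf
    by (intro integral_cong_AE AE_pmfI) (auto split: action.splits simp: indicator_def)
  have int: "integrable (measure_pmf (\<sigma> h)) (?f s)" for s
    by (intro measure_pmf.integrable_const_bound[where B = 1])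
       (auto split: action.splits simp: indicator_def)
  have "(\<Sum>s\<in>S. ?f s a) \<le> 2 ^ Suc K - 1" if a: "a \<in> set_pmf (\<sigma> h)" for a
  proof (cases a)
    case (Name v)
    have "(\<Sum>s\<in>S. ?f s a) = (if v \<in> S then 1 else 0)"
      using Suc.prems(1) Name by (simp add: indicator_def)
    then show ?thesis using one by simp
  next
    case (Watch v)
    have len: "length h' \<le> length h + K"
      if "s \<in> S" "(h', r) \<in> set_pmf (play \<sigma> (c s) k (h @ [(v, c s v)]))" for s h' r
    proof (rule Suc.prems(4)[OF that(1)])
      show "(h', r) \<in> set_pmf (play \<sigma> (c s) (Suc k) h)"
        using that(2) a Watch by (auto intro!: bexI[of _ "Watch v"])
    qed
    show ?thesis
    proof (cases "S = {}")
      case True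
      then show ?thesis using one by simp
    next
      case False
      then obtain s where s: "s \<in> S" by blast
      obtain h' r where h': "(h', r) \<in> set_pmf (play \<sigma> (c s) k (h @ [(v, c s v)]))"
        using set_pmf_not_empty by (metis ex_in_conv surj_pair)
      have "0 < K" using len[OF s h'] length_play[OF h'] by simp
      then obtain K' where K: "K = Suc K'" by (cases K) auto
      let ?S1 = "{s \<in> S. s < v}" and ?S2 = "{s \<in> S. v < s}" and ?S3 = "S \<inter> {v}"
      have S: "S = ?S1 \<union> (?S2 \<union> ?S3)" by auto
      have "(\<Sum>s\<in>S. ?f s a) = (\<Sum>s\<in>?S1. ?f s a) + ((\<Sum>s\<in>?S2. ?f s a) + (\<Sum>s\<in>?S3. ?f s a))"
        using Suc.prems(1) by (subst S, subst sum.union_disjoint) (auto intro!: sum.union_disjoint)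
      moreover have "(\<Sum>s\<in>?S1. ?f s a) \<le> 2 ^ Suc K' - 1"
      proof -
        have "(\<Sum>s\<in>?S1. ?f s a) = (\<Sum>s\<in>?S1. ?w k (h @ [(v, R v)]) s)"
          using Watch Suc.prems(2) by (intro sum.cong) auto
        also have "\<dots> \<le> 2 ^ Suc K' - 1"
          using Suc.prems(1-3) len by (intro Suc.IH) (fastforce simp: K)+
        finally show ?thesis .
      qed
      moreover have "(\<Sum>s\<in>?S2. ?f s a) \<le> 2 ^ Suc K' - 1"
      proof -
        have "(\<Sum>s\<in>?S2. ?f s a) = (\<Sum>s\<in>?S2. ?w k (h @ [(v, L v)]) s)"
          using Watch Suc.prems(3) by (intro sum.cong) auto
        also have "\<dots> \<le> 2 ^ Suc K' - 1"
          using Suc.prems(1-3) len by (intro Suc.IH) (fastforce simp: K)+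
        finally show ?thesis .
      qed
      moreover have "(\<Sum>s\<in>?S3. ?f s a) \<le> 1"
        by (cases "v \<in> S") (auto simp: Watch)
      ultimately show ?thesis by (simp add: K)
    qed
  qed
  then have "measure_pmf.expectation (\<sigma> h) (\<lambda>a. \<Sum>s\<in>S. ?f s a) \<le> 2 ^ Suc K - 1"
    by (intro measure_pmf.integral_le_const Bochner_Integration.integrable_sum int AE_pmfI)
  then show ?case
    by (simp only: w Bochner_Integration.integral_sum[OF int])
qed

lemma price_path_graph_ge:
  assumes "0 < n" and wins: "wins_on_trees p A" and price: "price A (path_graph n) \<le> enat (n * K)"
  shows "real n * p \<le> 2 ^ Suc K - 1"
proof -
  let ?\<sigma> = "A (path_graph n) n n"
  let ?w = "\<lambda>s k. measure_pmf.prob (play ?\<sigma> (spreading_chain n s) k []) {(h, r). r = Some s}"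
  have len: "length h \<le> K"
    if "s < n" "(h, r) \<in> set_pmf (play ?\<sigma> (spreading_chain n s) k [])" for s h r k
  proof -
    have "enat (\<Sum>j<length h. card {u \<in> fst (path_graph n). spreading_chain n s u \<noteq> None})
        \<le> price A (path_graph n)"
      unfolding price_def using that sd_instance_spreading[OF that(1)]
      by (intro Sup_upper CollectI) blast
    also note price
    finally have "enat (length h * n) \<le> enat (n * K)"
      using spreading_chain_infected by simp
    then show ?thesis using assms(1) by (simp add: mult.commute)
  qed
  have "(\<Sum>s<n. ?w s k) \<le> 2 ^ Suc K - 1" for k
    by (rule sum_prob_play_le[where R = "\<lambda>v. if n \<le> v then None else Some (v, Some (v - 1))"
          and L = "\<lambda>v. Some (n - v, Some (Suc v))"])
       (auto simp: spreading_chain_def dest: len)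
  moreover have "?w s \<longlonglongrightarrow> win_prob ?\<sigma> (spreading_chain n s) s" for s
    unfolding win_prob_def
    by (intro LIMSEQ_incseq_SUP incseq_SucI prob_play_mono) (auto intro!: bdd_aboveI[of _ 1])
  then have "(\<lambda>k. \<Sum>s<n. ?w s k) \<longlonglongrightarrow> (\<Sum>s<n. win_prob ?\<sigma> (spreading_chain n s) s)"
    by (intro tendsto_sum)
  ultimately have "(\<Sum>s<n. win_prob ?\<sigma> (spreading_chain n s) s) \<le> 2 ^ Suc K - 1"
    by (intro LIMSEQ_le_const2) auto
  moreover have "p \<le> win_prob ?\<sigma> (spreading_chain n s) s" if "s < n" for s
    using wins tree_path_graph[OF assms(1)] sd_instance_spreading[OF that]
    unfolding wins_on_trees_def by blast
  then have "(\<Sum>s<n. p) \<le> (\<Sum>s<n. win_prob ?\<sigma> (spreading_chain n s) s)"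
    by (intro sum_mono) auto
  ultimately show ?thesis by simp
qed

section \<open>The upper bound\<close>

definition watched :: "'v chain \<Rightarrow> 'v list \<Rightarrow> 'v history" where
  "watched c vs = map (\<lambda>v. (v, c v)) vs"

lemma in_set_watched: "(v, x) \<in> set (watched c vs) \<longleftrightarrow> v \<in> set vs \<and> c v = x"
  by (auto simp: watched_def)

text \<open>The fallback \<^term>\<open>SOME v. v \<in> V\<close> only concerns histories that no play produces.\<close>

definition search :: "'v set \<Rightarrow> ('v history \<Rightarrow> 'v) \<Rightarrow> 'v history \<Rightarrow> 'v action" where
  "search V target h =
     (let a = if \<exists>v t. (v, Some (t, None)) \<in> set h
              then Name (SOME v. \<exists>t. (v, Some (t, None)) \<in> set h) else Watch (target h)
      in if node a \<in> V then a else Name (SOME v. v \<in> V))"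

lemma node_search: "V \<noteq> {} \<Longrightarrow> node (search V target h) \<in> V"
  by (auto simp: search_def Let_def some_in_eq)

lemma search_found:
  assumes "\<And>v. (\<exists>t. c v = Some (t, None)) \<longleftrightarrow> v = s" and "s \<in> V" "s \<in> set vs"
  shows "search V target (watched c vs) = Name s"
proof -
  have "(\<exists>t. (v, Some (t, None)) \<in> set (watched c vs)) \<longleftrightarrow> v = s" for v
    using assms(1)[of v] assms(3) by (auto simp: in_set_watched)
  then show ?thesis using assms by (simp add: search_def Let_def)
qed

lemma search_continue:
  assumes "\<And>v. (\<exists>t. c v = Some (t, None)) \<longleftrightarrow> v = s" and "s \<notin> set vs" "target (watched c vs) \<in> V"
  shows "search V target (watched c vs) = Watch (target (watched c vs))"
proof -
  have "\<not> (\<exists>t. (v, Some (t, None)) \<in> set (watched c vs))" for v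
    using assms(1)[of v] assms(2) by (auto simp: in_set_watched)
  then show ?thesis using assms by (simp add: search_def)
qed

lemma play_search:
  assumes seed: "\<And>v. (\<exists>t. c v = Some (t, None)) \<longleftrightarrow> v = s" and "s \<in> V"
    and step: "\<And>vs. Inv vs \<Longrightarrow> s \<notin> set vs \<Longrightarrow>
      target (watched c vs) \<in> V \<and> Inv (vs @ [target (watched c vs)])"
    and bound: "\<And>vs. Inv vs \<Longrightarrow> length vs \<le> N"
    and "Inv vs"
    and "(h, r) \<in> set_pmf (play (\<lambda>h. return_pmf (search V target h)) c k (watched c vs))"
  shows "length h \<le> N \<and> (r = Some s \<or> length h = length vs + k)"
  using assms(5,6)
proof (induction k arbitrary: vs)
  case 0
  then show ?case using bound[of vs] by (simp add: watched_def)
next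
  case (Suc k)
  show ?case
  proof (cases "s \<in> set vs")
    case True
    have "search V target (watched c vs) = Name s"
      using seed \<open>s \<in> V\<close> True by (rule search_found)
    then show ?thesis
      using Suc.prems bound[of vs] by (simp add: bind_return_pmf watched_def)
  next
    case False
    let ?v = "target (watched c vs)"
    have st: "?v \<in> V" "Inv (vs @ [?v])" using step[OF Suc.prems(1) False] by auto
    have "search V target (watched c vs) = Watch ?v"
      using seed False st(1) by (rule search_continue)
    moreover have "watched c vs @ [(?v, c ?v)] = watched c (vs @ [?v])" by (simp add: watched_def)
    ultimately have
      "(h, r) \<in> set_pmf (play (\<lambda>h. return_pmf (search V target h)) c k (watched c (vs @ [?v])))"
      using Suc.prems(2) by (simp add: bind_return_pmf)
    from Suc.IH[OF st(2) this] show ?thesis by simp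
  qed
qed

lemma win_prob_search:
  assumes "\<And>v. (\<exists>t. c v = Some (t, None)) \<longleftrightarrow> v = s" and "s \<in> V"
    and "\<And>vs. Inv vs \<Longrightarrow> s \<notin> set vs \<Longrightarrow>
      target (watched c vs) \<in> V \<and> Inv (vs @ [target (watched c vs)])"
    and "\<And>vs. Inv vs \<Longrightarrow> length vs \<le> N"
    and "Inv []"
  shows "1 \<le> win_prob (\<lambda>h. return_pmf (search V target h)) c s"
proof -
  let ?M = "\<lambda>k. play (\<lambda>h. return_pmf (search V target h)) c k []"
  have "r = Some s" if "(h, r) \<in> set_pmf (?M (Suc N))" for h r
  proof -
    have "(h, r) \<in> set_pmf (play (\<lambda>h. return_pmf (search V target h)) c (Suc N) (watched c []))"
      using that by (simp add: watched_def)
    with assms have "length h \<le> N \<and> (r = Some s \<or> length h = length ([] :: 'a list) + Suc N)"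
      by (rule play_search)
    then show ?thesis by auto
  qed
  then have "1 = measure_pmf.prob (?M (Suc N)) {(h, r). r = Some s}"
    by (intro measure_pmf.prob_eq_1[THEN iffD2, symmetric])
       (auto simp: AE_measure_pmf_iff simp del: play.simps)
  also have "\<dots> \<le> win_prob (\<lambda>h. return_pmf (search V target h)) c s"
    unfolding win_prob_def by (intro cSUP_upper) (auto intro!: bdd_aboveI[of _ 1])
  finally show ?thesis .
qed

lemma finite_median:
  fixes S :: "'a::linorder set"
  assumes "finite S" "S \<noteq> {}"
  obtains v where "v \<in> S" "2 * card {x \<in> S. x < v} \<le> card S" "2 * card {x \<in> S. v < x} \<le> card S"
proof -
  define T where "T = {v \<in> S. 2 * card {x \<in> S. x < v} \<le> card S}"
  have "{x \<in> S. x < Min S} = {}" using assms by auto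
  then have "2 * card {x \<in> S. x < Min S} \<le> card S" by (simp only: card.empty)
  then have "Min S \<in> T" using Min_in[OF assms] unfolding T_def by blast
  then have nT: "T \<noteq> {}" by blast
  have fT: "finite T" using assms by (simp add: T_def)
  define v where "v = Max T"
  have "v \<in> T" using fT nT by (simp add: v_def)
  have "2 * card {x \<in> S. v < x} \<le> card S"
  proof (cases "{x \<in> S. v < x} = {}")
    case True
    then show ?thesis by (metis card.empty mult_0_right zero_le)
  next
    case False
    define w where "w = Min {x \<in> S. v < x}"
    have w: "w \<in> {x \<in> S. v < x}" using False assms unfolding w_def by (intro Min_in) auto
    have "w \<notin> T" using Max_ge[OF fT, of w] w by (auto simp: v_def)
    then have "card S < 2 * card {x \<in> S. x < w}" using w by (simp add: T_def)
    moreover have "x \<le> v" if "x \<in> S" "x < w" for x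
    proof (rule ccontr)
      assume "\<not> x \<le> v"
      then have "w \<le> x" using that assms unfolding w_def by (intro Min_le) auto
      with \<open>x < w\<close> show False by simp
    qed
    then have "{x \<in> S. x < w} \<inter> {x \<in> S. v < x} = {}" by force
    then have "card {x \<in> S. x < w} + card {x \<in> S. v < x} \<le> card S"
      using assms by (subst card_Un_disjoint[symmetric]) (auto intro!: card_mono)
    ultimately show ?thesis by linarith
  qed
  then show ?thesis using that \<open>v \<in> T\<close> by (auto simp: T_def)
qed

definition median :: "'a::linorder set \<Rightarrow> 'a" where
  "median S = (SOME v. v \<in> S \<and> 2 * card {x \<in> S. x < v} \<le> card S \<and> 2 * card {x \<in> S. v < x} \<le> card S)"

lemma median:
  assumes "finite S" "S \<noteq> {}"
  shows "median S \<in> S" "2 * card {x \<in> S. x < median S} \<le> card S"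
    "2 * card {x \<in> S. median S < x} \<le> card S"
proof -
  have "\<exists>v. v \<in> S \<and> 2 * card {x \<in> S. x < v} \<le> card S \<and> 2 * card {x \<in> S. v < x} \<le> card S"
    using finite_median[OF assms] by metis
  from someI_ex[OF this] show "median S \<in> S" "2 * card {x \<in> S. x < median S} \<le> card S"
    "2 * card {x \<in> S. median S < x} \<le> card S"
    by (auto simp: median_def)
qed

text \<open>
  Probing the multiples of ever smaller powers of two hits an interval of m infected nodes after
  O(2^i / m) rounds, each of which costs m.
\<close>

definition sweep_level :: "nat \<Rightarrow> nat \<Rightarrow> nat list" where
  "sweep_level i j = map (\<lambda>q. q * 2 ^ (i - j)) [0..<2 ^ j]"

definition sweep :: "nat \<Rightarrow> nat list" where
  "sweep i = concat (map (sweep_level i) [0..<Suc i])"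

lemma length_sweep_levels: "length (concat (map (sweep_level i) [0..<j])) = 2 ^ j - 1"
  by (induction j) (auto simp: sweep_level_def)

lemma set_sweep: "set (sweep i) \<subseteq> {..<2 ^ i}"
proof
  fix x assume "x \<in> set (sweep i)"
  then obtain j q where x: "j \<le> i" "q < 2 ^ j" "x = q * 2 ^ (i - j)"
    by (auto simp: sweep_def sweep_level_def less_Suc_eq_le simp del: upt_Suc)
  then have "x < 2 ^ j * 2 ^ (i - j)" by simp
  with x show "x \<in> {..<2 ^ i}" by (simp add: power_add[symmetric])
qed

lemma sweep_hits_interval:
  assumes "0 < m" "a + m \<le> 2 ^ i"
  obtains l where "l < length (sweep i)" "sweep i ! l \<in> {a..<a + m}" "Suc l * m \<le> 4 * 2 ^ i"
proof -
  obtain e where e: "2 ^ e \<le> m" "m < 2 ^ Suc e"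
    using ex_power_ivl1[of 2 m] assms(1) by auto
  then have "(2::nat) ^ e \<le> 2 ^ i" using assms by linarith
  then have "e \<le> i" by simp
  define j where "j = i - e"
  have ij: "e = i - j" "j \<le> i" "i = j + e" using \<open>e \<le> i\<close> by (auto simp: j_def)
  define q where "q = (a + 2 ^ e - 1) div 2 ^ e"
  have eq: "q * 2 ^ e + (a + 2 ^ e - 1) mod 2 ^ e = a + 2 ^ e - 1"
    by (simp only: q_def div_mult_mod_eq)
  have "(a + 2 ^ e - 1) mod 2 ^ e < (2::nat) ^ e" by simp
  then have q: "a \<le> q * 2 ^ e" "q * 2 ^ e < a + 2 ^ e" using eq by linarith+
  then have mem: "q * 2 ^ e \<in> {a..<a + m}" using e by simp
  then have "q * 2 ^ e < 2 ^ i" using assms(2) by simp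
  then have "q * 2 ^ e < 2 ^ j * 2 ^ e" by (simp only: ij(3) power_add)
  then have "q < 2 ^ j" by simp
  define pre where "pre = concat (map (sweep_level i) [0..<Suc j])"
  have "q * 2 ^ e \<in> set (sweep_level i j)"
    using \<open>q < 2 ^ j\<close> by (auto simp: sweep_level_def ij(1)[symmetric])
  then have "q * 2 ^ e \<in> set pre" by (simp add: pre_def)
  then obtain l where l: "l < length pre" "pre ! l = q * 2 ^ e" by (metis in_set_conv_nth)
  have "[0..<Suc i] = [0..<Suc j] @ [Suc j..<Suc i]"
    using upt_add_eq_append[of 0 "Suc j" e] ij(3) by (simp del: upt_Suc)
  then have split: "sweep i = pre @ concat (map (sweep_level i) [Suc j..<Suc i])"
    by (simp only: pre_def sweep_def map_append concat_append)
  have "length pre \<le> 2 ^ Suc j" unfolding pre_def length_sweep_levels by simp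
  then have "Suc l \<le> 2 ^ Suc j" using l(1) by simp
  then have "Suc l * m \<le> 2 ^ Suc j * 2 ^ Suc e" using e by (intro mult_le_mono) auto
  also have "\<dots> = 4 * 2 ^ i" by (simp add: ij(3) power_add)
  finally have "Suc l * m \<le> 4 * 2 ^ i" .
  moreover have "l < length (sweep i)" "sweep i ! l = q * 2 ^ e"
    using l by (auto simp add: split nth_append simp del: upt_Suc)
  ultimately show ?thesis using that mem by simp
qed

definition possible_sources :: "'v sgraph \<Rightarrow> 'v history \<Rightarrow> 'v set" where
  "possible_sources G h = {s \<in> fst G. \<exists>lam \<delta> t0 c. infection_chain G lam \<delta> s t0 c \<and>
     (\<forall>(v, x) \<in> set h. c v = x)}"

definition path_search :: "nat \<Rightarrow> nat history \<Rightarrow> nat" where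
  "path_search i h =
     (if \<exists>v x. (v, Some x) \<in> set h then median (possible_sources (path_graph (2 ^ i)) h)
      else sweep i ! length h)"

lemma possible_sources_halve:
  assumes chain: "infection_chain (path_graph n) lam \<delta> s t0 c"
    and hit: "a \<in> set vs" "c a \<noteq> None"
    and "S = possible_sources (path_graph n) (watched c vs)" and "median S \<noteq> s"
    and "s < n"
  shows "2 * card (possible_sources (path_graph n) (watched c (vs @ [median S]))) \<le> card S"
proof -
  let ?v = "median S" and ?S' = "possible_sources (path_graph n) (watched c (vs @ [median S]))"
  have S: "finite S" "s \<in> S"
    using assms by (auto simp: possible_sources_def watched_def intro: finite_subset[of _ "{..<n}"])
  have "(?v < s \<and> ?v < s') \<or> (s < ?v \<and> s' < ?v)" "s' \<in> S" if "s' \<in> ?S'" for s'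
  proof -
    from that obtain lam' \<delta>' t0' c' where
      c': "infection_chain (path_graph n) lam' \<delta>' s' t0' c'" "\<forall>(v, x) \<in> set (watched c (vs @ [?v])). c' v = x"
      by (auto simp: possible_sources_def)
    then have "c' ?v = c ?v" "c' a = c a" using hit by (auto simp: watched_def)
    then show "(?v < s \<and> ?v < s') \<or> (s < ?v \<and> s' < ?v)"
      using path_source_side[OF chain c'(1)] hit \<open>?v \<noteq> s\<close> by blast
    show "s' \<in> S" using that unfolding assms(4) by (auto simp: possible_sources_def watched_def)
  qed
  then have "?S' \<subseteq> {x \<in> S. ?v < x} \<or> ?S' \<subseteq> {x \<in> S. x < ?v}"
    using \<open>?v \<noteq> s\<close> by (cases "?v < s") fastforce+
  then have "card ?S' \<le> card {x \<in> S. ?v < x} \<or> card ?S' \<le> card {x \<in> S. x < ?v}"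
    using S(1) by (auto intro: card_mono)
  then show ?thesis using median[OF S(1)] S(2) by force
qed

text \<open>Sweeping ends with the l-th probe; the r later probes each halve the possible sources.\<close>

definition path_search_inv :: "nat \<Rightarrow> nat \<Rightarrow> nat chain \<Rightarrow> nat \<Rightarrow> nat list \<Rightarrow> bool" where
  "path_search_inv i l c s vs \<longleftrightarrow>
     (length vs \<le> l \<and> vs = take (length vs) (sweep i)) \<or>
     (\<exists>r \<le> Suc i. length vs = Suc l + r \<and> (\<exists>v\<in>set vs. c v \<noteq> None) \<and>
        (s \<in> set vs \<or> card (possible_sources (path_graph (2 ^ i)) (watched c vs)) * 2 ^ r \<le> 2 ^ i))"

lemma path_search_inv_step:
  assumes chain: "infection_chain (path_graph (2 ^ i)) lam \<delta> s t0 c" and s: "s < 2 ^ i"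
    and l: "l < length (sweep i)" "c (sweep i ! l) \<noteq> None"
      "\<forall>l'<l. c (sweep i ! l') = None"
    and inv: "path_search_inv i l c s vs" and "s \<notin> set vs"
  shows "path_search i (watched c vs) < 2 ^ i \<and>
    path_search_inv i l c s (vs @ [path_search i (watched c vs)])"
proof -
  let ?P = "\<lambda>vs. possible_sources (path_graph (2 ^ i)) (watched c vs)"
  have sub: "?P vs \<subseteq> {..<2 ^ i}" for vs by (auto simp: possible_sources_def)
  then have fin: "finite (?P vs)" for vs by (rule finite_subset) simp
  have hit: "(\<exists>v x. (v, Some x) \<in> set (watched c vs)) \<longleftrightarrow> (\<exists>v\<in>set vs. c v \<noteq> None)"
    by (auto simp: in_set_watched)
  consider (sweeping) "length vs \<le> l" "vs = take (length vs) (sweep i)"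
    | (halving) r where "length vs = Suc l + r" "\<exists>v\<in>set vs. c v \<noteq> None"
        "card (?P vs) * 2 ^ r \<le> 2 ^ i"
    using inv \<open>s \<notin> set vs\<close> unfolding path_search_inv_def by blast
  then show ?thesis
  proof cases
    case sweeping
    note len = sweeping(1) and vs = sweeping(2)
    have "c v = None" if v: "v \<in> set vs" for v
    proof -
      have "v \<in> set (take (length vs) (sweep i))" using v vs by simp
      then obtain j where "j < length vs" "v = sweep i ! j"
        by (auto simp: in_set_conv_nth)
      then show ?thesis using l(3) len by simp
    qed
    then have nxt: "path_search i (watched c vs) = sweep i ! length vs"
      using hit by (auto simp: path_search_def watched_def)
    have app: "vs @ [sweep i ! length vs] = take (Suc (length vs)) (sweep i)"
      using vs len l(1) by (simp add: take_Suc_conv_app_nth)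
    have "sweep i ! length vs \<in> set (sweep i)" using len l(1) by simp
    then have lt: "sweep i ! length vs < 2 ^ i" using set_sweep by blast
    show ?thesis
    proof (cases "length vs = l")
      case True
      have "card (?P (vs @ [sweep i ! l])) \<le> 2 ^ i"
        using card_mono[OF _ sub] by simp
      then show ?thesis unfolding nxt path_search_inv_def using True lt l(2) by auto
    next
      case False
      then have "length (vs @ [sweep i ! length vs]) \<le> l" using len by simp
      moreover have "vs @ [sweep i ! length vs] = take (length (vs @ [sweep i ! length vs])) (sweep i)"
        using app by (metis length_append_singleton)
      ultimately show ?thesis unfolding nxt path_search_inv_def using lt by blast
    qed
  next
    case halving
    note card = halving(3)
    have "s \<in> ?P vs" using chain s by (auto simp: possible_sources_def watched_def)
    then have "1 \<le> card (?P vs)" using fin by (metis One_nat_def Suc_leI card_gt_0_iff empty_iff)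
    then have "1 * 2 ^ r \<le> card (?P vs) * 2 ^ r" by (rule mult_le_mono1)
    then have "(2::nat) ^ r \<le> 2 ^ i" using card by linarith
    then have "r \<le> i" by simp
    define v where "v = median (?P vs)"
    have nxt: "path_search i (watched c vs) = v"
      using halving(2) hit by (simp add: path_search_def v_def)
    have "v \<in> ?P vs" using median(1)[OF fin] \<open>s \<in> ?P vs\<close> unfolding v_def by blast
    then have lt: "v < 2 ^ i" using sub by blast
    have "s \<in> set (vs @ [v]) \<or> card (?P (vs @ [v])) * 2 ^ Suc r \<le> 2 ^ i"
    proof (cases "s = v")
      case False
      obtain a where "a \<in> set vs" "c a \<noteq> None" using halving(2) by blast
      then have "2 * card (?P (vs @ [v])) \<le> card (?P vs)"
        using possible_sources_halve[OF chain _ _ refl _ s] False unfolding v_def by metis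
      then have "2 * card (?P (vs @ [v])) * 2 ^ r \<le> card (?P vs) * 2 ^ r" by (rule mult_le_mono1)
      then have "card (?P (vs @ [v])) * 2 ^ Suc r \<le> card (?P vs) * 2 ^ r" by (simp add: ac_simps)
      then show ?thesis using card by linarith
    qed simp
    moreover have "length (vs @ [v]) = Suc l + Suc r" "\<exists>v\<in>set (vs @ [v]). c v \<noteq> None" "Suc r \<le> Suc i"
      using halving(1,2) \<open>r \<le> i\<close> by auto
    ultimately have "path_search_inv i l c s (vs @ [v])"
      unfolding path_search_inv_def by blast
    then show ?thesis unfolding nxt using lt by blast
  qed
qed

lemma path_search_cost:
  assumes chain: "infection_chain (path_graph (2 ^ i)) lam \<delta> s t0 c"
  obtains l where "l < length (sweep i)" "c (sweep i ! l) \<noteq> None"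
    and "\<forall>l'<l. c (sweep i ! l') = None"
    and "(l + i + 2) * card {u \<in> {..<2 ^ i}. c u \<noteq> None} \<le> 2 ^ i * (i + 5)"
proof -
  obtain a m where I: "{u \<in> {..<2 ^ i}. c u \<noteq> None} = {a..<a + m}" and m: "0 < m"
    using path_infected_interval[OF chain] by blast
  have "a + m - 1 \<in> {u \<in> {..<2 ^ i}. c u \<noteq> None}" unfolding I using m by auto
  then have am: "a + m \<le> 2 ^ i" using m by auto
  define P where "P l \<longleftrightarrow> l < length (sweep i) \<and> c (sweep i ! l) \<noteq> None" for l
  obtain l0 where l0: "l0 < length (sweep i)" "sweep i ! l0 \<in> {a..<a + m}" "Suc l0 * m \<le> 4 * 2 ^ i"
    using sweep_hits_interval[OF m am] .
  then have "sweep i ! l0 \<in> {u \<in> {..<2 ^ i}. c u \<noteq> None}" by (simp only: I)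
  then have "P l0" using l0(1) by (simp add: P_def)
  define l where "l = (LEAST l. P l)"
  have "P l" "l \<le> l0" unfolding l_def using \<open>P l0\<close> by (rule LeastI, rule Least_le)
  have "c (sweep i ! l') = None" if "l' < l" for l'
  proof -
    have "\<not> P l'" using that unfolding l_def by (rule not_less_Least)
    moreover have "l' < length (sweep i)" using that \<open>P l\<close> by (simp add: P_def)
    ultimately show ?thesis unfolding P_def by blast
  qed
  then have min: "\<forall>l'<l. c (sweep i ! l') = None" by blast
  have "(l + i + 2) * m \<le> Suc l0 * m + Suc i * m"
    using \<open>l \<le> l0\<close> by (simp add: algebra_simps)
  also have "\<dots> \<le> 4 * 2 ^ i + Suc i * 2 ^ i"
    using am by (intro add_mono l0(3) mult_le_mono) auto
  finally have "(l + i + 2) * card {u \<in> {..<2 ^ i}. c u \<noteq> None} \<le> 2 ^ i * (i + 5)"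
    unfolding I by (simp add: algebra_simps)
  with \<open>P l\<close> min show ?thesis using that unfolding P_def by blast
qed

definition discoverer_target :: "nat sgraph \<Rightarrow> nat history \<Rightarrow> nat" where
  "discoverer_target G h =
     (if \<exists>i. G = path_graph (2 ^ i) then path_search (THE i. G = path_graph (2 ^ i)) h
      else sorted_list_of_set (fst G) ! length h)"

definition discoverer :: "nat discoverer" where
  "discoverer G Tmax \<delta> h = return_pmf (search (fst G) (discoverer_target G) h)"

lemma discoverer_target_path: "discoverer_target (path_graph (2 ^ i)) = path_search i"
proof -
  have "path_graph (2 ^ i) = path_graph (2 ^ j) \<longleftrightarrow> j = i" for j
    by (metis fst_path_graph lessThan_eq_iff one_less_numeral_iff power_inject_exp semiring_norm(76))
  then have "(THE j. path_graph (2 ^ i) = path_graph (2 ^ j)) = i" by simp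
  then show ?thesis by (intro ext) (auto simp: discoverer_target_def)
qed

lemma infection_chain_seed_iff:
  assumes "infection_chain G lam \<delta> s t0 c"
  shows "(\<exists>t. c v = Some (t, None)) \<longleftrightarrow> v = s"
  using infection_chain_seed_unique[OF assms] assms by (auto simp: infection_chain_def)

lemma price_discoverer: "price discoverer (path_graph (2 ^ i)) \<le> enat (2 ^ i * (i + 5))"
  unfolding price_def
proof (rule Sup_least, elim CollectE exE conjE)
  fix x Tmax \<delta> lam s t0 c k h r
  assume x: "x = enat (\<Sum>j<length h. card {u \<in> fst (path_graph (2 ^ i)). c u \<noteq> None})"
    and inst: "sd_instance (path_graph (2 ^ i)) Tmax \<delta> lam s t0 c"
    and play: "(h, r) \<in> set_pmf (play (discoverer (path_graph (2 ^ i)) Tmax \<delta>) c k [])"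
  have chain: "infection_chain (path_graph (2 ^ i)) lam \<delta> s t0 c" and s: "s < 2 ^ i"
    using inst by (auto simp: sd_instance_def)
  obtain l where l: "l < length (sweep i)" "c (sweep i ! l) \<noteq> None"
      "\<forall>l'<l. c (sweep i ! l') = None"
    and cost: "(l + i + 2) * card {u \<in> {..<2 ^ i}. c u \<noteq> None} \<le> 2 ^ i * (i + 5)"
    using path_search_cost[OF chain] by blast
  have "(h, r) \<in> set_pmf (play (\<lambda>h. return_pmf (search {..<2 ^ i} (path_search i) h)) c k (watched c []))"
    using play unfolding discoverer_def by (simp add: discoverer_target_path watched_def)
  then have "length h \<le> l + i + 2 \<and> (r = Some s \<or> length h = length ([] :: nat list) + k)"
  proof (rule play_search[where Inv = "path_search_inv i l c s", rotated -1])
    show "path_search i (watched c vs) \<in> {..<2 ^ i} \<and>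
        path_search_inv i l c s (vs @ [path_search i (watched c vs)])"
      if "path_search_inv i l c s vs" "s \<notin> set vs" for vs
      using path_search_inv_step[OF chain s l that] by simp
  qed (use infection_chain_seed_iff[OF chain] s in \<open>auto simp: path_search_inv_def\<close>)
  then have "length h * card {u \<in> {..<2 ^ i}. c u \<noteq> None}
      \<le> (l + i + 2) * card {u \<in> {..<2 ^ i}. c u \<noteq> None}"
    by (intro mult_le_mono1) simp
  then show "x \<le> enat (2 ^ i * (i + 5))" using cost by (simp add: x)
qed

lemma win_prob_discoverer:
  assumes inst: "sd_instance G Tmax \<delta> lam s t0 c"
  shows "1 \<le> win_prob (discoverer G Tmax \<delta>) c s"
proof (cases "\<exists>i. G = path_graph (2 ^ i)")
  case True
  then obtain i where G: "G = path_graph (2 ^ i)" by blast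
  have chain: "infection_chain (path_graph (2 ^ i)) lam \<delta> s t0 c" and s: "s < 2 ^ i"
    using inst by (auto simp: sd_instance_def G)
  obtain l where l: "l < length (sweep i)" "c (sweep i ! l) \<noteq> None"
      "\<forall>l'<l. c (sweep i ! l') = None"
    by (rule path_search_cost[OF chain]) (rule that)
  have "1 \<le> win_prob (\<lambda>h. return_pmf (search {..<2 ^ i} (path_search i) h)) c s"
  proof (rule win_prob_search[where Inv = "path_search_inv i l c s" and N = "l + i + 2"])
    show "path_search i (watched c vs) \<in> {..<2 ^ i} \<and>
        path_search_inv i l c s (vs @ [path_search i (watched c vs)])"
      if "path_search_inv i l c s vs" "s \<notin> set vs" for vs
      using path_search_inv_step[OF chain s l that] by simp
  qed (use infection_chain_seed_iff[OF chain] s in \<open>auto simp: path_search_inv_def\<close>)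
  then show ?thesis unfolding G discoverer_def by (simp add: discoverer_target_path)
next
  case False
  have chain: "infection_chain G lam \<delta> s t0 c" and s: "s \<in> fst G" and fin: "finite (fst G)"
    using inst by (auto simp: sd_instance_def simple_graph_def)
  define xs where "xs = sorted_list_of_set (fst G)"
  have xs: "set xs = fst G" using fin by (simp add: xs_def)
  have target: "discoverer_target G (watched c vs) = xs ! length vs" for vs
    using False by (simp add: discoverer_target_def watched_def xs_def)
  let ?Inv = "\<lambda>vs. \<exists>j \<le> length xs. vs = take j xs"
  have "1 \<le> win_prob (\<lambda>h. return_pmf (search (fst G) (discoverer_target G) h)) c s"
  proof (rule win_prob_search[where Inv = ?Inv and N = "length xs"])
    fix vs assume "?Inv vs" and "s \<notin> set vs"
    then obtain j where j: "j \<le> length xs" "vs = take j xs" by blast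
    then have "j \<noteq> length xs" using \<open>s \<notin> set vs\<close> s xs by auto
    then have "j < length xs" using j by simp
    have "length vs = j" "vs @ [xs ! j] = take (Suc j) xs" "Suc j \<le> length xs"
      using j \<open>j < length xs\<close> by (simp_all add: take_Suc_conv_app_nth)
    moreover have "xs ! j \<in> fst G" using nth_mem[OF \<open>j < length xs\<close>] by (simp only: xs)
    ultimately show "discoverer_target G (watched c vs) \<in> fst G \<and>
        ?Inv (vs @ [discoverer_target G (watched c vs)])"
      unfolding target by blast
  next
    show "(\<exists>t. c v = Some (t, None)) \<longleftrightarrow> v = s" for v
      by (rule infection_chain_seed_iff[OF chain])
  qed (use s in auto)
  then show ?thesis unfolding discoverer_def .
qed

lemma wins_on_trees_discoverer:
  assumes "p \<le> 1"
  shows "wins_on_trees p discoverer"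
  unfolding wins_on_trees_def
proof (intro allI impI conjI)
  fix G :: "nat sgraph" and Tmax \<delta> h
  assume "tree_graph G"
  then show "node ` set_pmf (discoverer G Tmax \<delta> h) \<subseteq> fst G"
    by (simp add: discoverer_def node_search tree_graph_def)
qed (use assms win_prob_discoverer in \<open>blast intro: order_trans\<close>)

section \<open>The asymptotics\<close>

lemma price_path_graph_power_ge:
  assumes "0 < p" "wins_on_trees p A"
  shows "ereal (2 ^ i * (i + log 2 p - 2)) \<le> ereal_of_enat (price A (path_graph (2 ^ i)))"
proof (cases "price A (path_graph (2 ^ i))")
  case (enat N)
  define K where "K = Suc (N div 2 ^ i)"
  have "N = 2 ^ i * (N div 2 ^ i) + N mod 2 ^ i" by simp
  moreover have "N mod 2 ^ i < 2 ^ i" by simp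
  ultimately have N: "N \<le> 2 ^ i * K" "2 ^ i * (N div 2 ^ i) \<le> N"
    unfolding K_def mult_Suc_right by linarith+
  have "real (2 ^ i) * p \<le> 2 ^ Suc K - 1"
    using price_path_graph_ge[of "2 ^ i" p A K] assms enat N by simp
  then have "2 ^ i * p < 2 ^ Suc K" by simp
  then have "log 2 (2 ^ i * p) < log 2 (2 ^ Suc K)" using assms by simp
  then have "i + log 2 p < Suc K" using assms by (simp add: log_mult log_nat_power)
  then have "i + log 2 p - 2 \<le> real (N div 2 ^ i)" by (simp add: K_def)
  then have "2 ^ i * (i + log 2 p - 2) \<le> 2 ^ i * real (N div 2 ^ i)" by (intro mult_left_mono) auto
  also have "\<dots> = real (2 ^ i * (N div 2 ^ i))" by simp
  also have "\<dots> \<le> real N" using N(2) by (simp only: of_nat_le_iff)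
  finally show ?thesis by (simp add: enat)
qed simp

lemma price_ratio_path_graph:
  "price_ratio A (path_graph (2 ^ i)) = ereal_of_enat (price A (path_graph (2 ^ i))) / ereal (2 ^ i * i)"
  by (simp add: price_ratio_def log_nat_power)

lemma price_ratio_ge:
  assumes "0 < p" "wins_on_trees p A" "0 < i"
  shows "ereal ((i + log 2 p - 2) / i) \<le> price_ratio A (path_graph (2 ^ i))"
proof -
  have "ereal (2 ^ i * (i + log 2 p - 2)) / ereal (2 ^ i * i) \<le> price_ratio A (path_graph (2 ^ i))"
    unfolding price_ratio_path_graph using assms price_path_graph_power_ge
    by (intro ereal_divide_right_mono) auto
  then show ?thesis using assms(3) by simp
qed

lemma liminf_price_ratio_ge:
  assumes "0 < p" "wins_on_trees p A"
  shows "1 \<le> liminf (\<lambda>i. price_ratio A (path_graph (2 ^ i)))"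
proof -
  have "(\<lambda>i. (real i + log 2 p - 2) / real i) \<longlonglongrightarrow> 1"
    by real_asymp
  then have "(\<lambda>i. ereal ((real i + log 2 p - 2) / real i)) \<longlonglongrightarrow> 1"
    by (simp add: one_ereal_def)
  then have "1 = liminf (\<lambda>i. ereal ((real i + log 2 p - 2) / real i))"
    by (intro lim_imp_Liminf[symmetric]) auto
  also have "\<dots> \<le> liminf (\<lambda>i. price_ratio A (path_graph (2 ^ i)))"
    by (intro Liminf_mono eventually_mono[OF eventually_gt_at_top[of 0]] price_ratio_ge assms)
  finally show ?thesis .
qed

lemma asymp_optimal_discoverer:
  assumes "0 < p" "p \<le> 1"
  shows "asymp_optimal p (\<lambda>i. path_graph (2 ^ i)) discoverer"
  unfolding asymp_optimal_def
proof (intro conjI allI impI)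
  show "wins_on_trees p discoverer" using assms wins_on_trees_discoverer by blast
next
  fix B :: "nat discoverer" and \<epsilon> :: real
  assume B: "wins_on_trees p B" and "0 < \<epsilon>"
  have "\<forall>\<^sub>F i in sequentially. real i + 5 \<le> (1 + \<epsilon>) * (real i + log 2 p - 2)"
    using \<open>0 < \<epsilon>\<close> by real_asymp
  then show "\<forall>\<^sub>F i in sequentially. ereal_of_enat (price discoverer (path_graph (2 ^ i)))
      \<le> ereal (1 + \<epsilon>) * ereal_of_enat (price B (path_graph (2 ^ i)))"
  proof (rule eventually_mono)
    fix i assume i: "real i + 5 \<le> (1 + \<epsilon>) * (real i + log 2 p - 2)"
    have "ereal_of_enat (price discoverer (path_graph (2 ^ i))) \<le> ereal_of_enat (enat (2 ^ i * (i + 5)))"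
      by (simp only: ereal_of_enat_le_iff price_discoverer)
    also have "\<dots> = ereal (2 ^ i * (real i + 5))" by simp
    also have "\<dots> \<le> ereal (2 ^ i * ((1 + \<epsilon>) * (real i + log 2 p - 2)))"
      using i by (simp only: ereal_less_eq mult_left_mono zero_le_power zero_le_numeral)
    also have "\<dots> = ereal (1 + \<epsilon>) * ereal (2 ^ i * (i + log 2 p - 2))" by simp
    also have "\<dots> \<le> ereal (1 + \<epsilon>) * ereal_of_enat (price B (path_graph (2 ^ i)))"
      using \<open>0 < \<epsilon>\<close> price_path_graph_power_ge[OF assms(1) B] by (intro ereal_mult_left_mono) auto
    finally show "ereal_of_enat (price discoverer (path_graph (2 ^ i)))
      \<le> ereal (1 + \<epsilon>) * ereal_of_enat (price B (path_graph (2 ^ i)))" .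
  qed
qed

lemma asymp_optimal_price_ratio:
  assumes "0 < p" "p \<le> 1" and A: "asymp_optimal p (\<lambda>i. path_graph (2 ^ i)) A"
  shows "(\<lambda>i. price_ratio A (path_graph (2 ^ i))) \<longlonglongrightarrow> 1"
proof (rule order_tendstoI)
  fix a :: ereal assume "a < 1"
  also have "1 \<le> liminf (\<lambda>i. price_ratio A (path_graph (2 ^ i)))"
    using liminf_price_ratio_ge assms by (auto simp: asymp_optimal_def)
  finally show "\<forall>\<^sub>F i in sequentially. a < price_ratio A (path_graph (2 ^ i))"
    by (rule less_LiminfD)
next
  fix a :: ereal assume "1 < a"
  then obtain b where b: "1 < ereal b" "ereal b < a" using ereal_dense2 by blast
  define \<epsilon> where "\<epsilon> = (b - 1) / 2"
  have \<epsilon>: "0 < \<epsilon>" "b = 1 + 2 * \<epsilon>" using b(1) by (auto simp: \<epsilon>_def field_simps)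
  have "\<forall>\<^sub>F i in sequentially. (1 + \<epsilon>) * (real i + 5) \<le> b * real i"
    using \<epsilon>(1) unfolding \<epsilon>(2) by real_asymp
  moreover have "\<forall>\<^sub>F i in sequentially. ereal_of_enat (price A (path_graph (2 ^ i)))
      \<le> ereal (1 + \<epsilon>) * ereal_of_enat (price discoverer (path_graph (2 ^ i)))"
    using A wins_on_trees_discoverer[OF assms(2)] \<epsilon>(1) unfolding asymp_optimal_def by blast
  ultimately show "\<forall>\<^sub>F i in sequentially. price_ratio A (path_graph (2 ^ i)) < a"
    using eventually_gt_at_top[of 0]
  proof eventually_elim
    case (elim i)
    note elim(2)
    also have "ereal (1 + \<epsilon>) * ereal_of_enat (price discoverer (path_graph (2 ^ i)))
        \<le> ereal (1 + \<epsilon>) * ereal_of_enat (enat (2 ^ i * (i + 5)))"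
      using price_discoverer \<epsilon>(1) by (intro ereal_mult_left_mono) (simp_all only: ereal_of_enat_le_iff, simp)
    also have "\<dots> = ereal (2 ^ i * ((1 + \<epsilon>) * (real i + 5)))" by simp
    also have "\<dots> \<le> ereal (2 ^ i * (b * real i))"
      using elim(1) by (simp only: ereal_less_eq mult_left_mono zero_le_power zero_le_numeral)
    finally have "price_ratio A (path_graph (2 ^ i)) \<le> ereal (2 ^ i * (b * real i)) / ereal (2 ^ i * i)"
      unfolding price_ratio_path_graph using elim(3) by (intro ereal_divide_right_mono) auto
    also have "\<dots> = ereal b" using elim(3) by simp
    finally show ?case using b(2) by simp
  qed
qed

theorem theorem5:
  shows "\<exists>P :: nat \<Rightarrow> nat sgraph.
    (\<forall>i. tree_graph (P i)) \<and> strict_mono (\<lambda>i. card (fst (P i))) \<and>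
    (\<forall>p::real. 0 < p \<and> p \<le> 1 \<longrightarrow>
       (\<forall>A. wins_on_trees p A \<longrightarrow> 1 \<le> liminf (\<lambda>i. price_ratio A (P i))) \<and>
       (\<exists>A. asymp_optimal p P A) \<and>
       (\<forall>A. asymp_optimal p P A \<longrightarrow> (\<lambda>i. price_ratio A (P i)) \<longlonglongrightarrow> 1))"
proof (intro exI[of _ "\<lambda>i. path_graph (2 ^ i)"] conjI allI impI)
  show "tree_graph (path_graph (2 ^ i))" for i
    by (simp add: tree_path_graph)
  show "strict_mono (\<lambda>i. card (fst (path_graph (2 ^ i))))"
    by (simp add: strict_mono_def)
qed (use liminf_price_ratio_ge asymp_optimal_discoverer asymp_optimal_price_ratio in blast)+

end
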